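(* Let $\Omega$ be a complex manifold with Kobayashi distance $d_\Omega$, fix $x_0\in\Omega$, and put $$\langle x\,|\,y\rangle^{\Omega}_{x_0}=\tfrac12\bigl(d_\Omega(x_0,x)+d_\Omega(x_0,y)-d_\Omega(x,y)\bigr)\qquad (x,y\in\Omega).$$ Suppose that $\Omega$ is biholomorphic to the product manifold $M_1\times M_2$ of some complex manifolds $M_1$, $M_2$, and that it admits a holomorphic mapping $f\colon\mathbb{D}\to\Omega$ from the unit disk $\mathbb{D}\subset\mathbb{C}$ with the property that there is a measurable set $E\subset\partial\mathbb{D}$ of positive linear measure such that for any $z_0\in E$ there is a sequence $\{z_n\}_{n=1}^\infty\subset\mathbb{D}$ such that $z_n\to z_0$ nontangentially and $d_\Omega(x_0,f(z_n))\to\infty$. Then the rigidity property for holomorphic disks does not hold for $\Omega$; that is, there exist holomorphic mappings $g_1,g_2\colon\mathbb{D}\to\Omega$ with $g_1\neq g_2$ and a measurable set $E'\subset\partial\mathbb{D}$ of positive linear measure such that for any $z_0\in E'$ there is a sequence $\{z_n\}_{n=1}^\infty\subset\mathbb{D}$ such that $z_n\to z_0$ nontangentially and $\langle g_1(z_n)\,|\,g_2(z_n)\rangle^{\Omega}_{x_0}\to\infty$ as $n\to\infty$.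
   Context: The Kobayashi distance $d_\Omega$ (in general only a pseudodistance) is the largest pseudodistance on $\Omega$ such that $d_\Omega(\phi(a),\phi(b))\le d_{\mathbb{D}}(a,b)$ for all holomorphic $\phi\colon\mathbb{D}\to\Omega$ and $a,b\in\mathbb{D}$, where $d_{\mathbb{D}}$ is the Poincaré distance of curvature $-4$ on $\mathbb{D}$. The rigidity property for holomorphic disks in $\Omega$ is the statement: whenever $g_1,g_2\colon\mathbb{D}\to\Omega$ are holomorphic and there is a measurable set $E\subset\partial\mathbb{D}$ of positive linear measure such that for any $z_0\in E$ there is a sequence $\{z_n\}\subset\mathbb{D}$ with $z_n\to z_0$ nontangentially and $\langle g_1(z_n)\,|\,g_2(z_n)\rangle^{\Omega}_{x_0}\to\infty$, then $g_1(z)=g_2(z)$ for all $z\in\mathbb{D}$. Linear measure on $\partial\mathbb{D}$ is arc-length measure. A sequence in $\mathbb{D}$ is said to converge to $z_0\in\partial\mathbb{D}$ nontangentially if it tends to $z_0$ from the inside of any fixed Stolz region with the vertex at $z_0$ (a Stolz region with vertex $z_0$ being a nontangential approach region at $z_0$, e.g. a set of the form $\{z\in\mathbb{D}: |z-z_0|<C(1-|z|)\}$ with $C>1$).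
   Formalization: The factors M_1 and M_2 are taken to be of positive dimension; if a one-point factor were allowed, every manifold would be a product and the claim would fail, for example for the unit disk itself with f the identity. *)

theory Defs
  imports "HOL-Analysis.Analysis"
begin

section \<open>Complex manifolds\<close>

text \<open>Holomorphy in several variables: Frechet differentiability with a derivative that is
  linear over the complex numbers. It is only used on open sets, which is why the derivative is
  taken at \<^term>\<open>at x\<close> and not within the set.\<close>

definition vec_holomorphic_on ::
    "(complex^'n \<Rightarrow> complex^'m) \<Rightarrow> (complex^'n) set \<Rightarrow> bool" where
  "vec_holomorphic_on F S \<longleftrightarrow>
     (\<forall>x\<in>S. \<exists>F'. (F has_derivative F') (at x) \<and> (\<forall>c v. F' (c *s v) = c *s F' v))"

text \<open>A space with charts into \<^typ>\<open>complex^'n\<close>, where a chart is a pair of its domain and the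
  coordinate map (whose values off the domain are irrelevant). Since \<open>CARD('n) \<ge> 1\<close>, all manifolds
  below have positive dimension. This is needed for the factors of a product decomposition: every
  manifold is the product of itself with a point.\<close>

record ('a, 'n::finite) charted =
  mtop :: "'a topology"
  charts :: "('a set \<times> ('a \<Rightarrow> complex^'n)) set"

abbreviation points :: "('a, 'n::finite) charted \<Rightarrow> 'a set" where
  "points M \<equiv> topspace (mtop M)"

definition complex_manifold :: "('a, 'n::finite) charted \<Rightarrow> bool" where
  "complex_manifold M \<longleftrightarrow>
     Hausdorff_space (mtop M) \<and> second_countable (mtop M) \<and>
     (\<Union>(U, \<phi>)\<in>charts M. U) = points M \<and>
     (\<forall>(U, \<phi>)\<in>charts M. openin (mtop M) U \<and> open (\<phi> ` U) \<and>
        homeomorphic_map (subtopology (mtop M) U) (top_of_set (\<phi> ` U)) \<phi>) \<and>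
     (\<forall>(U, \<phi>)\<in>charts M. \<forall>(V, \<psi>)\<in>charts M.
        vec_holomorphic_on (\<psi> \<circ> inv_into U \<phi>) (\<phi> ` (U \<inter> V)))"

definition holomorphic_map ::
    "('a, 'n::finite) charted \<Rightarrow> ('b, 'm::finite) charted \<Rightarrow> ('a \<Rightarrow> 'b) \<Rightarrow> bool" where
  "holomorphic_map M N F \<longleftrightarrow>
     continuous_map (mtop M) (mtop N) F \<and>
     (\<forall>(U, \<phi>)\<in>charts M. \<forall>(V, \<psi>)\<in>charts N.
        vec_holomorphic_on (\<psi> \<circ> F \<circ> inv_into U \<phi>) (\<phi> ` (U \<inter> F -` V)))"

definition biholomorphic ::
    "('a, 'n::finite) charted \<Rightarrow> ('b, 'm::finite) charted \<Rightarrow> bool" where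
  "biholomorphic M N \<longleftrightarrow>
     (\<exists>F G. homeomorphic_maps (mtop M) (mtop N) F G \<and>
            holomorphic_map M N F \<and> holomorphic_map N M G)"

definition prod_chart ::
    "('a \<Rightarrow> complex^'n) \<Rightarrow> ('b \<Rightarrow> complex^'m) \<Rightarrow> 'a \<times> 'b \<Rightarrow> complex^('n + 'm)" where
  "prod_chart \<phi> \<psi> = (\<lambda>(x, y). \<chi> k. case k of Inl i \<Rightarrow> \<phi> x $ i | Inr j \<Rightarrow> \<psi> y $ j)"

definition product_manifold ::
    "('a, 'n::finite) charted \<Rightarrow> ('b, 'm::finite) charted \<Rightarrow> ('a \<times> 'b, 'n + 'm) charted" where
  "product_manifold M N =
     \<lparr>mtop = prod_topology (mtop M) (mtop N),
      charts = {(U \<times> V, prod_chart \<phi> \<psi>) | U \<phi> V \<psi>. (U, \<phi>) \<in> charts M \<and> (V, \<psi>) \<in> charts N}\<rparr>"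


section \<open>Holomorphic disks and the Kobayashi distance\<close>

abbreviation unit_disk :: "complex set" where
  "unit_disk \<equiv> ball 0 1"

definition holomorphic_disk :: "('a, 'n::finite) charted \<Rightarrow> (complex \<Rightarrow> 'a) \<Rightarrow> bool" where
  "holomorphic_disk M f \<longleftrightarrow>
     continuous_map (top_of_set unit_disk) (mtop M) f \<and>
     (\<forall>(U, \<phi>)\<in>charts M. \<forall>i. (\<lambda>z. \<phi> (f z) $ i) holomorphic_on (unit_disk \<inter> f -` U))"

text \<open>The distance of the metric \<open>|dz| / (1 - |z|\<^sup>2)\<close>, which has curvature -4.\<close>

definition poincare_distance :: "complex \<Rightarrow> complex \<Rightarrow> real" where
  "poincare_distance a b = artanh (cmod ((a - b) / (1 - cnj a * b)))"

definition pseudodistance_on :: "'a set \<Rightarrow> ('a \<Rightarrow> 'a \<Rightarrow> real) \<Rightarrow> bool" where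
  "pseudodistance_on S d \<longleftrightarrow>
     (\<forall>x\<in>S. \<forall>y\<in>S. d x y \<ge> 0 \<and> d x y = d y x) \<and> (\<forall>x\<in>S. d x x = 0) \<and>
     (\<forall>x\<in>S. \<forall>y\<in>S. \<forall>z\<in>S. d x z \<le> d x y + d y z)"

definition disk_contracting ::
    "('a, 'n::finite) charted \<Rightarrow> ('a \<Rightarrow> 'a \<Rightarrow> real) \<Rightarrow> bool" where
  "disk_contracting M d \<longleftrightarrow>
     (\<forall>f. holomorphic_disk M f \<longrightarrow>
        (\<forall>a\<in>unit_disk. \<forall>b\<in>unit_disk. d (f a) (f b) \<le> poincare_distance a b))"

text \<open>The Kobayashi distance is the greatest element of a set of real-valued pseudodistances, which
  determines its values on \<^term>\<open>points M\<close>. A greatest element exists when the manifold is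
  connected (lemma \<open>kobayashi_distance_exists\<close>), and not when it is disconnected.\<close>

definition kobayashi_distance ::
    "('a, 'n::finite) charted \<Rightarrow> ('a \<Rightarrow> 'a \<Rightarrow> real) \<Rightarrow> bool" where
  "kobayashi_distance M d \<longleftrightarrow>
     pseudodistance_on (points M) d \<and> disk_contracting M d \<and>
     (\<forall>d'. pseudodistance_on (points M) d' \<and> disk_contracting M d' \<longrightarrow>
        (\<forall>x\<in>points M. \<forall>y\<in>points M. d' x y \<le> d x y))"

lemma kobayashi_distance_unique:
  assumes "kobayashi_distance M d" "kobayashi_distance M d'" "x \<in> points M" "y \<in> points M"
  shows "d x y = d' x y"
  using assms unfolding kobayashi_distance_def by (meson order_antisym)

lemma holomorphic_disk_in_chart:
  assumes M: "complex_manifold M" and c: "(U, \<phi>) \<in> charts M"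
    and sub: "\<And>z. z \<in> unit_disk \<Longrightarrow> a + z *s v \<in> \<phi> ` U"
  shows "holomorphic_disk M (\<lambda>z. inv_into U \<phi> (a + z *s v))"
proof -
  let ?g = "inv_into U \<phi>" and ?l = "\<lambda>z. a + z *s v"
  have U: "openin (mtop M) U"
    and hom: "homeomorphic_map (subtopology (mtop M) U) (top_of_set (\<phi> ` U)) \<phi>"
    using M c unfolding complex_manifold_def by auto
  have topU: "topspace (subtopology (mtop M) U) = U"
    using openin_subset[OF U] by auto
  obtain h where h: "homeomorphic_maps (subtopology (mtop M) U) (top_of_set (\<phi> ` U)) \<phi> h"
    using hom by (auto simp: homeomorphic_map_maps)
  have inj: "inj_on \<phi> U"
    using homeomorphic_imp_injective_map[OF hom] topU by simp
  have "continuous_map (top_of_set (\<phi> ` U)) (subtopology (mtop M) U) h"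
    using h by (simp add: homeomorphic_maps_def)
  moreover have "h y = ?g y" if y: "y \<in> \<phi> ` U" for y
  proof -
    obtain x where "x \<in> U" "y = \<phi> x" using y by auto
    then show ?thesis using h inj topU by (auto simp: homeomorphic_maps_def)
  qed
  ultimately have contg: "continuous_map (top_of_set (\<phi> ` U)) (subtopology (mtop M) U) ?g"
    by (metis (no_types, lifting) continuous_map_eq topspace_euclidean_subtopology)
  have der_l: "(?l has_derivative (\<lambda>h. h *s v)) (at z)" for z :: complex
  proof -
    have "bounded_linear (\<lambda>h::complex. h *s v)"
      by (rule linear_conv_bounded_linear[THEN iffD1], rule linearI)
         (auto simp: vec_eq_iff algebra_simps)
    then have "((\<lambda>z. z *s v) has_derivative (\<lambda>h. h *s v)) (at z)"
      by (rule bounded_linear_imp_has_derivative)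
    from has_derivative_add[OF has_derivative_const[of a] this] show ?thesis by simp
  qed
  then have "continuous_on unit_disk ?l"
    by (meson continuous_at_imp_continuous_on has_derivative_continuous)
  then have "continuous_map (top_of_set unit_disk) (top_of_set (\<phi> ` U)) ?l"
    using sub by (auto simp: continuous_map_in_subtopology)
  from continuous_map_compose[OF this contg]
  have cont: "continuous_map (top_of_set unit_disk) (mtop M) (\<lambda>z. ?g (?l z))"
    by (simp add: o_def continuous_map_in_subtopology)
  have "(\<lambda>z. \<psi> (?g (?l z)) $ i) holomorphic_on (unit_disk \<inter> (\<lambda>z. ?g (?l z)) -` V)"
    if V: "(V, \<psi>) \<in> charts M" for V \<psi> i
    unfolding holomorphic_on_def
  proof
    fix z assume z: "z \<in> unit_disk \<inter> (\<lambda>z. ?g (?l z)) -` V"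
    then have "?g (?l z) \<in> U \<inter> V" "\<phi> (?g (?l z)) = ?l z"
      using sub[of z] by (auto simp: inv_into_into f_inv_into_f)
    then have "?l z \<in> \<phi> ` (U \<inter> V)" by (metis imageI)
    moreover have "vec_holomorphic_on (\<psi> \<circ> ?g) (\<phi> ` (U \<inter> V))"
      using M c V unfolding complex_manifold_def by fast
    ultimately obtain F' where F': "(\<psi> \<circ> ?g has_derivative F') (at (?l z))"
      and lin: "\<And>c v. F' (c *s v) = c *s F' v"
      unfolding vec_holomorphic_on_def by blast
    have "(\<psi> \<circ> ?g \<circ> ?l has_derivative (\<lambda>h. F' (h *s v))) (at z)"
      using diff_chain_at[OF der_l F'] by (simp add: o_def)
    then have "((\<lambda>z. \<psi> (?g (?l z)) $ i) has_derivative (\<lambda>h. F' (h *s v) $ i)) (at z)"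
      using bounded_linear.has_derivative[OF bounded_linear_vec_nth] by (fastforce simp: o_def)
    moreover have "(\<lambda>h. F' (h *s v) $ i) = (*) (F' v $ i)"
      by (rule ext) (simp add: lin)
    ultimately have "((\<lambda>z. \<psi> (?g (?l z)) $ i) has_field_derivative (F' v $ i)) (at z)"
      by (simp only: has_field_derivative_def)
    then show "(\<lambda>z. \<psi> (?g (?l z)) $ i) field_differentiable
        at z within (unit_disk \<inter> (\<lambda>z. ?g (?l z)) -` V)"
      using field_differentiable_at_within field_differentiable_def by blast
  qed
  with cont show ?thesis unfolding holomorphic_disk_def by auto
qed

lemma pseudodistances_locally_bounded:
  assumes M: "complex_manifold M" and p: "p \<in> points M"
  shows "\<exists>W. openin (mtop M) W \<and> p \<in> W \<and> (\<forall>q\<in>W. \<forall>d. disk_contracting M d \<longrightarrow>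
            d p q \<le> poincare_distance 0 (1/2))"
proof -
  obtain U \<phi> where c: "(U, \<phi>) \<in> charts M" and pU: "p \<in> U"
    using M p unfolding complex_manifold_def by blast
  have U: "openin (mtop M) U" and op: "open (\<phi> ` U)"
    and hom: "homeomorphic_map (subtopology (mtop M) U) (top_of_set (\<phi> ` U)) \<phi>"
    using M c unfolding complex_manifold_def by auto
  have topU: "topspace (subtopology (mtop M) U) = U"
    using openin_subset[OF U] by auto
  have inj: "inj_on \<phi> U"
    using homeomorphic_imp_injective_map[OF hom] topU by simp
  obtain r where r: "r > 0" "ball (\<phi> p) r \<subseteq> \<phi> ` U"
    using op pU open_contains_ball by (metis imageI)
  define W where "W = {q \<in> U. \<phi> q \<in> ball (\<phi> p) (r/2)}"
  have "openin (subtopology (mtop M) U) {q \<in> topspace (subtopology (mtop M) U).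
          \<phi> q \<in> \<phi> ` U \<inter> ball (\<phi> p) (r/2)}"
    using homeomorphic_imp_continuous_map[OF hom]
    by (rule openin_continuous_map_preimage) (simp add: openin_open_Int)
  moreover have "{q \<in> topspace (subtopology (mtop M) U). \<phi> q \<in> \<phi> ` U \<inter> ball (\<phi> p) (r/2)} = W"
    unfolding topU W_def by auto
  ultimately have "openin (mtop M) W"
    using U by (simp add: openin_trans_full)
  moreover have "p \<in> W" using pU r by (simp add: W_def)
  moreover have "d p q \<le> poincare_distance 0 (1/2)"
    if q: "q \<in> W" and d: "disk_contracting M d" for q d
  proof -
    define v where "v = 2 *s (\<phi> q - \<phi> p)"
    have nrm: "norm (z *s w) = cmod z * norm w" for z :: complex and w :: "complex^'b"
      unfolding norm_vec_def L2_set_def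
      by (simp add: norm_mult power_mult_distrib sum_distrib_left[symmetric] real_sqrt_mult)
    have v: "norm v < r"
      using q unfolding v_def W_def nrm by (simp add: dist_norm norm_minus_commute)
    have "\<phi> p + z *s v \<in> \<phi> ` U" if "z \<in> unit_disk" for z
    proof -
      have "norm (z *s v) \<le> 1 * norm v"
        unfolding nrm using that by (intro mult_right_mono) auto
      then show ?thesis using v r(2) by (auto simp: dist_norm subset_iff)
    qed
    from holomorphic_disk_in_chart[OF M c this]
    have "d (inv_into U \<phi> (\<phi> p + 0 *s v)) (inv_into U \<phi> (\<phi> p + (1/2) *s v))
            \<le> poincare_distance 0 (1/2)"
      using d unfolding disk_contracting_def by fastforce
    moreover have "\<phi> p + (1/2) *s v = \<phi> q"
      by (simp add: v_def vec_eq_iff)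
    moreover have "inv_into U \<phi> (\<phi> p) = p" "inv_into U \<phi> (\<phi> q) = q"
      using inj pU q by (auto simp: W_def)
    ultimately show ?thesis by simp
  qed
  ultimately show ?thesis by blast
qed

lemma kobayashi_distance_exists:
  assumes M: "complex_manifold M" and conn: "connected_space (mtop M)"
  shows "\<exists>d. kobayashi_distance M d"
proof -
  define F where "F = {d. pseudodistance_on (points M) d \<and> disk_contracting M d}"
  define K where "K x y = (SUP d\<in>F. d x y)" for x y
  have bdd: "bdd_above ((\<lambda>d. d x y) ` F)" if x: "x \<in> points M" and y: "y \<in> points M" for x y
  proof -
    define T where "T = {y \<in> points M. bdd_above ((\<lambda>d. d x y) ` F)}"
    have step: "bdd_above ((\<lambda>d. d x b) ` F)"
      if bd: "bdd_above ((\<lambda>d. d x a) ` F)" and "a \<in> points M" "b \<in> points M"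
        "\<And>d. d \<in> F \<Longrightarrow> d a b \<le> B" for a b B
    proof -
      obtain A where A: "\<And>d. d \<in> F \<Longrightarrow> d x a \<le> A"
        using bd by (auto simp: bdd_above_def)
      have "d x b \<le> A + B" if "d \<in> F" for d
      proof -
        have "d x b \<le> d x a + d a b"
          using that \<open>a \<in> points M\<close> \<open>b \<in> points M\<close> x
          by (auto simp: F_def pseudodistance_on_def)
        with A[OF that] \<open>\<And>d. d \<in> F \<Longrightarrow> d a b \<le> B\<close>[OF that] show ?thesis by linarith
      qed
      then show ?thesis by (auto simp: bdd_above_def)
    qed
    have sym: "d a b = d b a" if "d \<in> F" "a \<in> points M" "b \<in> points M" for d a b
      using that by (auto simp: F_def pseudodistance_on_def)
    have loc: "\<exists>W. openin (mtop M) W \<and> p \<in> W \<and> (W \<subseteq> T \<or> W \<inter> T = {})"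
      if p: "p \<in> points M" for p
    proof -
      obtain W where W: "openin (mtop M) W" "p \<in> W"
        and le: "\<And>q d. q \<in> W \<Longrightarrow> d \<in> F \<Longrightarrow> d p q \<le> poincare_distance 0 (1/2)"
        using pseudodistances_locally_bounded[OF M p] unfolding F_def by blast
      have WM: "q \<in> points M" if "q \<in> W" for q
        using that openin_subset[OF W(1)] by blast
      show ?thesis
      proof (cases "p \<in> T")
        case True
        then have "bdd_above ((\<lambda>d. d x p) ` F)" by (simp add: T_def)
        then have "bdd_above ((\<lambda>d. d x q) ` F)" if "q \<in> W" for q
          using step[of p q "poincare_distance 0 (1/2)"] le WM p that by simp
        then have "W \<subseteq> T" using WM by (auto simp: T_def)
        with W show ?thesis by blast
      next
        case False
        have "q \<notin> T" if q: "q \<in> W" for q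
        proof
          assume "q \<in> T"
          moreover have "d q p \<le> poincare_distance 0 (1/2)" if "d \<in> F" for d
            using le[OF q that] sym[OF that WM[OF q] p] by simp
          ultimately have "p \<in> T"
            using step[of q p "poincare_distance 0 (1/2)"] WM[OF q] p by (simp add: T_def)
          with False show False by blast
        qed
        with W show ?thesis by blast
      qed
    qed
    have "openin (mtop M) T"
      unfolding openin_subopen[of _ T]
    proof
      fix p assume p: "p \<in> T"
      then have "p \<in> points M" by (simp add: T_def)
      from loc[OF this] p show "\<exists>W. openin (mtop M) W \<and> p \<in> W \<and> W \<subseteq> T" by blast
    qed
    moreover have "openin (mtop M) (points M - T)"
      unfolding openin_subopen[of _ "points M - T"]
    proof
      fix p assume p: "p \<in> points M - T"
      then obtain W where W: "openin (mtop M) W" "p \<in> W" "W \<subseteq> T \<or> W \<inter> T = {}"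
        using loc by blast
      then show "\<exists>W. openin (mtop M) W \<and> p \<in> W \<and> W \<subseteq> points M - T"
        using p openin_subset[OF W(1)] by blast
    qed
    then have "closedin (mtop M) T"
      by (auto simp: closedin_def T_def)
    moreover have "x \<in> T"
      using x by (auto simp: T_def bdd_above_def F_def pseudodistance_on_def)
    ultimately have "T = points M"
      using conn unfolding connected_space_clopen_in by blast
    with y show ?thesis by (auto simp: T_def)
  qed
  have "(\<lambda>x y. 0) \<in> F"
  proof -
    have "0 \<le> poincare_distance a b" if ab: "a \<in> unit_disk" "b \<in> unit_disk" for a b
    proof -
      have "cmod ((a - b) / (1 - cnj a * b)) < 1"
      proof -
        have "(cmod (1 - cnj a * b))\<^sup>2 - (cmod (a - b))\<^sup>2 = (1 - (cmod a)\<^sup>2) * (1 - (cmod b)\<^sup>2)"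
          unfolding cmod_power2 by (simp add: power2_eq_square algebra_simps)
        moreover have "0 < (1 - (cmod a)\<^sup>2) * (1 - (cmod b)\<^sup>2)"
          using ab by (intro mult_pos_pos) (auto simp: power_less_one_iff abs_square_less_1)
        ultimately have "(cmod (a - b))\<^sup>2 < (cmod (1 - cnj a * b))\<^sup>2" by linarith
        then have "cmod (a - b) < cmod (1 - cnj a * b)"
          by (rule power2_less_imp_less) simp
        then show ?thesis
          by (simp add: norm_divide divide_less_eq)
      qed
      then show ?thesis
        unfolding poincare_distance_def artanh_def by (simp add: field_simps)
    qed
    then show ?thesis by (auto simp: F_def pseudodistance_on_def disk_contracting_def)
  qed
  then have ne: "F \<noteq> {}" by blast
  have upper: "d x y \<le> K x y" if "d \<in> F" "x \<in> points M" "y \<in> points M" for d x y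
    unfolding K_def using that bdd by (intro cSUP_upper)
  have least: "K x y \<le> B" if "\<And>d. d \<in> F \<Longrightarrow> d x y \<le> B" for x y B
    unfolding K_def using ne that by (intro cSUP_least) auto
  have "pseudodistance_on (points M) K"
    unfolding pseudodistance_on_def
  proof (intro conjI ballI)
    fix x y assume xy: "x \<in> points M" "y \<in> points M"
    show "0 \<le> K x y" using upper[OF \<open>(\<lambda>x y. 0) \<in> F\<close> xy] .
    have "d x y = d y x" if "d \<in> F" for d
      using that xy by (auto simp: F_def pseudodistance_on_def)
    then show "K x y = K y x" unfolding K_def by (intro SUP_cong) auto
  next
    fix x assume x: "x \<in> points M"
    have "d x x = 0" if "d \<in> F" for d
      using that x by (auto simp: F_def pseudodistance_on_def)
    then have "K x x = (SUP d\<in>F. 0)" unfolding K_def by (intro SUP_cong) auto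
    then show "K x x = 0" using ne by simp
  next
    fix x y z assume xyz: "x \<in> points M" "y \<in> points M" "z \<in> points M"
    show "K x z \<le> K x y + K y z"
    proof (rule least)
      fix d assume d: "d \<in> F"
      have "d x z \<le> d x y + d y z"
        using d xyz by (auto simp: F_def pseudodistance_on_def)
      also have "\<dots> \<le> K x y + K y z"
        using d xyz by (intro add_mono upper)
      finally show "d x z \<le> K x y + K y z" .
    qed
  qed
  moreover have "disk_contracting M K"
    unfolding disk_contracting_def
    by (intro allI impI ballI least) (auto simp: F_def disk_contracting_def)
  ultimately show ?thesis
    using upper unfolding kobayashi_distance_def F_def by blast
qed

definition gromov_product :: "('a \<Rightarrow> 'a \<Rightarrow> real) \<Rightarrow> 'a \<Rightarrow> 'a \<Rightarrow> 'a \<Rightarrow> real" where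
  "gromov_product d x0 x y = (d x0 x + d x0 y - d x y) / 2"


section \<open>Boundary behaviour and the rigidity property\<close>

definition stolz_region :: "real \<Rightarrow> complex \<Rightarrow> complex set" where
  "stolz_region C z0 = {z \<in> unit_disk. cmod (z - z0) < C * (1 - cmod z)}"

definition tends_nontangentially :: "(nat \<Rightarrow> complex) \<Rightarrow> complex \<Rightarrow> bool" where
  "tends_nontangentially z z0 \<longleftrightarrow>
     z \<longlonglongrightarrow> z0 \<and> (\<exists>C>1. \<forall>n. z n \<in> stolz_region C z0)"

text \<open>Arc-length measure on the unit circle is transported from Lebesgue measure by the
  parametrization \<^term>\<open>cis\<close>.\<close>

definition circle_arguments :: "complex set \<Rightarrow> real set" where
  "circle_arguments E = {t \<in> {0..<2 * pi}. cis t \<in> E}"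

definition positive_linear_measure :: "complex set \<Rightarrow> bool" where
  "positive_linear_measure E \<longleftrightarrow>
     E \<subseteq> sphere 0 1 \<and> circle_arguments E \<in> sets lebesgue \<and>
     emeasure lebesgue (circle_arguments E) > 0"

definition rigidity_property ::
    "('a, 'n::finite) charted \<Rightarrow> ('a \<Rightarrow> 'a \<Rightarrow> real) \<Rightarrow> 'a \<Rightarrow> bool" where
  "rigidity_property M d x0 \<longleftrightarrow>
     (\<forall>g1 g2. holomorphic_disk M g1 \<longrightarrow> holomorphic_disk M g2 \<longrightarrow>
        (\<exists>E. positive_linear_measure E \<and>
           (\<forall>z0\<in>E. \<exists>z. tends_nontangentially z z0 \<and>
              filterlim (\<lambda>n. gromov_product d x0 (g1 (z n)) (g2 (z n))) at_top sequentially)) \<longrightarrow>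
        (\<forall>z\<in>unit_disk. g1 z = g2 z))"

end

theory Submission
  imports Defs
begin

text \<open>Write \<open>x0 = (x1, x2)\<close> and \<open>f = (f1, f2)\<close> in \<open>M1 \<times> M2\<close>. The Kobayashi distance does not
  increase under the self-maps \<open>(u, v) \<mapsto> (a, v)\<close> and \<open>(u, v) \<mapsto> (u, b)\<close>, so \<open>d ((a, v), (a, w))\<close> does
  not depend on \<open>a\<close>, and the triangle inequality gives
  \<open>d (x0, f) \<le> d (x0, (f1, x2)) + d (x0, (x1, f2))\<close>. At every point of \<open>E\<close> one of the two summands is
  therefore unbounded in some Stolz region. The set of points where this happens for a given summand
  is Borel, because Stolz regions depend on their vertex in an open way; so one summand, say the
  first, is unbounded on a set of positive measure. The disks \<open>(f1, x2)\<close> and \<open>(f1, c)\<close> with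
  \<open>c \<noteq> x2\<close> are then at bounded distance from each other, and their Gromov product is unbounded.\<close>

section \<open>Holomorphic disks under maps and products\<close>

lemma openin_disk_preimage:
  assumes "continuous_map (top_of_set unit_disk) X f" "openin X U"
  shows "open (unit_disk \<inter> f -` U)"
proof -
  have "openin (top_of_set unit_disk) {z \<in> topspace (top_of_set unit_disk). f z \<in> U}"
    using assms by (rule openin_continuous_map_preimage)
  moreover have "{z \<in> topspace (top_of_set unit_disk). f z \<in> U} = unit_disk \<inter> f -` U" by auto
  ultimately show ?thesis by (metis open_ball openin_open_eq)
qed

lemma holomorphic_disk_in_points:
  "holomorphic_disk M f \<Longrightarrow> z \<in> unit_disk \<Longrightarrow> f z \<in> points M"
  unfolding holomorphic_disk_def by (auto simp: continuous_map_def)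

text \<open>Chain rule in a chart around \<open>f z\<close>. The assumptions list what this takes
  from the atlas of \<open>M\<close>, so that the lemma applies both to \<open>\<Omega>\<close> and
  to the product manifold, for which just these chart properties are established.\<close>

lemma holomorphic_disk_comp:
  assumes cover: "\<And>x. x \<in> points M \<Longrightarrow> \<exists>(U, \<phi>)\<in>charts M. x \<in> U"
    and chart: "\<And>U \<phi>. (U, \<phi>) \<in> charts M \<Longrightarrow> openin (mtop M) U \<and> inj_on \<phi> U"
    and f: "holomorphic_disk M f" and F: "holomorphic_map M N F"
  shows "holomorphic_disk N (\<lambda>z. F (f z))"
  unfolding holomorphic_disk_def
proof (intro conjI ballI allI, safe)
  have contf: "continuous_map (top_of_set unit_disk) (mtop M) f"
    using f by (simp add: holomorphic_disk_def)
  show "continuous_map (top_of_set unit_disk) (mtop N) (\<lambda>z. F (f z))"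
    using continuous_map_compose[OF contf] F by (auto simp: holomorphic_map_def o_def)
  fix V \<psi> i assume V: "(V, \<psi>) \<in> charts N"
  show "(\<lambda>z. \<psi> (F (f z)) $ i) holomorphic_on (unit_disk \<inter> (\<lambda>z. F (f z)) -` V)"
    unfolding holomorphic_on_def
  proof
    fix z assume z: "z \<in> unit_disk \<inter> (\<lambda>z. F (f z)) -` V"
    then have "f z \<in> points M" using f by (auto intro: holomorphic_disk_in_points)
    then obtain U \<phi> where c: "(U, \<phi>) \<in> charts M" and fz: "f z \<in> U" using cover by blast
    let ?W = "unit_disk \<inter> f -` U"
    have opW: "open ?W" using openin_disk_preimage[OF contf] chart[OF c] by blast
    have zW: "z \<in> ?W" using z fz by blast
    have "\<exists>v. ((\<lambda>z. \<phi> (f z) $ j) has_field_derivative v) (at z)" for j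
    proof -
      have "(\<lambda>z. \<phi> (f z) $ j) holomorphic_on ?W"
        using f c by (auto simp: holomorphic_disk_def)
      then show ?thesis
        using opW zW by (meson holomorphic_on_imp_differentiable_at field_differentiable_def)
    qed
    then obtain v where v: "\<And>j. ((\<lambda>z. \<phi> (f z) $ j) has_field_derivative v j) (at z)" by metis
    \<comment> \<open>The complex derivatives \<open>v j\<close> of the coordinates assemble into
      one Frechet derivative. Written as \<open>h *s vec_lambda v\<close>, it lets the complex
      linearity of \<open>F'\<close> turn the composite into multiplication by a fixed
      number.\<close>
    have "((\<lambda>z. \<chi> j. \<phi> (f z) $ j) has_derivative (\<lambda>h. \<chi> j. v j * h)) (at z)"
      by (subst has_derivative_componentwise_within)
         (use v[unfolded has_field_derivative_def] in
            \<open>auto simp: Basis_vec_def inner_axis intro: has_derivative_inner_left\<close>)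
    moreover have "(\<lambda>h. \<chi> j. v j * h) = (\<lambda>h. h *s vec_lambda v)"
      by (auto simp: vec_eq_iff)
    ultimately have der: "((\<lambda>z. \<phi> (f z)) has_derivative (\<lambda>h. h *s vec_lambda v)) (at z)"
      by simp
    have inv: "inv_into U \<phi> (\<phi> x) = x" if "x \<in> U" for x
      using that chart[OF c] by simp
    have "vec_holomorphic_on (\<psi> \<circ> F \<circ> inv_into U \<phi>) (\<phi> ` (U \<inter> F -` V))"
      using F c V unfolding holomorphic_map_def by fast
    moreover have "\<phi> (f z) \<in> \<phi> ` (U \<inter> F -` V)" using z fz by blast
    ultimately obtain F' where
      F': "(\<psi> \<circ> F \<circ> inv_into U \<phi> has_derivative F') (at (\<phi> (f z)))"
      and lin: "\<And>c v. F' (c *s v) = c *s F' v"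
      unfolding vec_holomorphic_on_def by blast
    have "(\<psi> \<circ> F \<circ> inv_into U \<phi> \<circ> (\<lambda>z. \<phi> (f z)) has_derivative (\<lambda>h. F' (h *s vec_lambda v))) (at z)"
      using diff_chain_at[OF der F'] by (simp add: o_def)
    then have "((\<lambda>z. \<psi> (F (inv_into U \<phi> (\<phi> (f z)))) $ i)
                  has_derivative (\<lambda>h. F' (h *s vec_lambda v) $ i)) (at z)"
      using bounded_linear.has_derivative[OF bounded_linear_vec_nth] by (fastforce simp: o_def)
    moreover have "(\<lambda>h. F' (h *s vec_lambda v) $ i) = (*) (F' (vec_lambda v) $ i)"
      by (rule ext) (simp add: lin)
    ultimately have "((\<lambda>z. \<psi> (F (inv_into U \<phi> (\<phi> (f z)))) $ i)
                  has_field_derivative (F' (vec_lambda v) $ i)) (at z)"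
      by (simp only: has_field_derivative_def)
    \<comment> \<open>The chart and its inverse cancel where \<open>f\<close> stays in
      \<open>U\<close>, that is on the open set \<open>?W\<close> around \<open>z\<close>.\<close>
    then have "((\<lambda>z. \<psi> (F (f z)) $ i) has_field_derivative (F' (vec_lambda v) $ i)) (at z)"
      by (rule has_field_derivative_transform_within_open[OF _ opW zW]) (simp add: inv)
    then show "(\<lambda>z. \<psi> (F (f z)) $ i) field_differentiable
        at z within (unit_disk \<inter> (\<lambda>z. F (f z)) -` V)"
      using field_differentiable_at_within field_differentiable_def by blast
  qed
qed

lemma holomorphic_disk_const: "c \<in> points M \<Longrightarrow> holomorphic_disk M (\<lambda>z. c)"
  unfolding holomorphic_disk_def by auto

section \<open>Charts of manifolds and of their products\<close>

lemma complex_manifold_cover: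
  "complex_manifold M \<Longrightarrow> x \<in> points M \<Longrightarrow> \<exists>(U, \<phi>)\<in>charts M. x \<in> U"
  unfolding complex_manifold_def by blast

lemma complex_manifold_chart:
  assumes "complex_manifold M" "(U, \<phi>) \<in> charts M"
  shows "openin (mtop M) U \<and> inj_on \<phi> U"
proof -
  have U: "openin (mtop M) U"
    and hom: "homeomorphic_map (subtopology (mtop M) U) (top_of_set (\<phi> ` U)) \<phi>"
    using assms unfolding complex_manifold_def by auto
  have "topspace (subtopology (mtop M) U) = U"
    using openin_subset[OF U] by auto
  then show ?thesis using U homeomorphic_imp_injective_map[OF hom] by simp
qed

text \<open>The coordinate space has positive dimension, so its nonempty open sets are never
  singletons, and neither is a chart domain. This supplies the constant \<open>c\<close> that
  separates the two disks at the end.\<close>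

lemma complex_manifold_other_point:
  assumes M: "complex_manifold M" and x: "x \<in> points M"
  obtains y where "y \<in> points M" "y \<noteq> x"
proof -
  obtain U \<phi> where c: "(U, \<phi>) \<in> charts M" and xU: "x \<in> U"
    using complex_manifold_cover[OF assms] by blast
  have "open (\<phi> ` U)" using M c unfolding complex_manifold_def by auto
  then have "\<phi> ` U \<noteq> {\<phi> x}" using not_open_singleton by metis
  then obtain y where "y \<in> U" "\<phi> y \<noteq> \<phi> x" using xU by blast
  moreover have "U \<subseteq> points M" using complex_manifold_chart[OF M c] openin_subset by blast
  ultimately show thesis using that by blast
qed

lemma mtop_product [simp]: "mtop (product_manifold M N) = prod_topology (mtop M) (mtop N)"
  by (simp add: product_manifold_def)

lemma product_manifold_cover:
  assumes "complex_manifold M" "complex_manifold N" "x \<in> points (product_manifold M N)"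
  shows "\<exists>(U, \<phi>)\<in>charts (product_manifold M N). x \<in> U"
proof -
  obtain U \<phi> where "(U, \<phi>) \<in> charts M" "fst x \<in> U"
    using complex_manifold_cover[OF assms(1)] assms(3) by fastforce
  moreover obtain V \<psi> where "(V, \<psi>) \<in> charts N" "snd x \<in> V"
    using complex_manifold_cover[OF assms(2)] assms(3) by fastforce
  ultimately have "(U \<times> V, prod_chart \<phi> \<psi>) \<in> charts (product_manifold M N)" "x \<in> U \<times> V"
    by (auto simp: product_manifold_def mem_Times_iff)
  then show ?thesis by (intro bexI[where x = "(U \<times> V, prod_chart \<phi> \<psi>)"]) simp_all
qed

lemma prod_chart_Inl: "prod_chart \<phi> \<psi> x $ Inl i = \<phi> (fst x) $ i"
  and prod_chart_Inr: "prod_chart \<phi> \<psi> x $ Inr j = \<psi> (snd x) $ j"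
  by (simp_all add: prod_chart_def split_beta)

text \<open>Together with \<open>product_manifold_cover\<close> this provides what
  \<open>holomorphic_disk_comp\<close> asks of the product. Injectivity is read off separately from
  the two blocks of coordinates.\<close>

lemma product_manifold_chart:
  assumes M: "complex_manifold M" and N: "complex_manifold N"
    and c: "(W, \<rho>) \<in> charts (product_manifold M N)"
  shows "openin (mtop (product_manifold M N)) W \<and> inj_on \<rho> W"
proof -
  obtain U \<phi> V \<psi> where W: "W = U \<times> V" "\<rho> = prod_chart \<phi> \<psi>"
    and U: "(U, \<phi>) \<in> charts M" and V: "(V, \<psi>) \<in> charts N"
    using c by (auto simp: product_manifold_def)
  note U = complex_manifold_chart[OF M U] and V = complex_manifold_chart[OF N V]
  have "x = y" if "x \<in> W" "y \<in> W" and eq: "\<rho> x = \<rho> y" for x y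
  proof -
    have "\<phi> (fst x) = \<phi> (fst y)" "\<psi> (snd x) = \<psi> (snd y)"
      using eq unfolding W(2) by (metis prod_chart_Inl vec_eq_iff, metis prod_chart_Inr vec_eq_iff)
    then show ?thesis
      using that U V unfolding W(1) by (auto simp: inj_on_def mem_Times_iff prod_eq_iff)
  qed
  then show ?thesis using U V W(1) by (auto simp: inj_on_def openin_prod_Times_iff)
qed

section \<open>Disks in a product and their components\<close>

lemma holomorphic_disk_Pair:
  assumes "holomorphic_disk M f" "holomorphic_disk N g"
  shows "holomorphic_disk (product_manifold M N) (\<lambda>z. (f z, g z))"
  unfolding holomorphic_disk_def
proof (intro conjI ballI allI, safe)
  show "continuous_map (top_of_set unit_disk) (mtop (product_manifold M N)) (\<lambda>z. (f z, g z))"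
    using assms by (simp add: holomorphic_disk_def continuous_map_paired)
  fix W \<rho> and k :: "'b + 'd" assume "(W, \<rho>) \<in> charts (product_manifold M N)"
  then obtain U \<phi> V \<psi> where W: "W = U \<times> V" "\<rho> = prod_chart \<phi> \<psi>"
    and U: "(U, \<phi>) \<in> charts M" and V: "(V, \<psi>) \<in> charts N"
    by (auto simp: product_manifold_def)
  let ?S = "unit_disk \<inter> (\<lambda>z. (f z, g z)) -` W"
  have "(\<lambda>z. \<phi> (f z) $ i) holomorphic_on ?S" for i
    by (rule holomorphic_on_subset[of _ "unit_disk \<inter> f -` U"])
       (use assms(1) U W in \<open>auto simp: holomorphic_disk_def\<close>)
  moreover have "(\<lambda>z. \<psi> (g z) $ j) holomorphic_on ?S" for j
    by (rule holomorphic_on_subset[of _ "unit_disk \<inter> g -` V"])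
       (use assms(2) V W in \<open>auto simp: holomorphic_disk_def\<close>)
  ultimately show "(\<lambda>z. \<rho> (f z, g z) $ k) holomorphic_on ?S"
    by (cases k) (simp_all add: W(2) prod_chart_Inl prod_chart_Inr)
qed

text \<open>The atlas of the product consists of pairs of charts, so the coordinates of one
  component are read after choosing a chart of the other factor. That chart depends on the point,
  hence holomorphy is checked pointwise.\<close>

lemma
  assumes M: "complex_manifold M" and N: "complex_manifold N"
    and f: "holomorphic_disk (product_manifold M N) f"
  shows holomorphic_disk_fst: "holomorphic_disk M (\<lambda>z. fst (f z))"
    and holomorphic_disk_snd: "holomorphic_disk N (\<lambda>z. snd (f z))"
proof -
  have contf: "continuous_map (top_of_set unit_disk) (prod_topology (mtop M) (mtop N)) f"
    using f by (simp add: holomorphic_disk_def)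
  then have cont: "continuous_map (top_of_set unit_disk) (mtop M) (\<lambda>z. fst (f z))"
      "continuous_map (top_of_set unit_disk) (mtop N) (\<lambda>z. snd (f z))"
    using continuous_map_pairwise by (fastforce simp: o_def)+
  have coord: "(\<lambda>z. prod_chart \<phi> \<psi> (f z) $ k) field_differentiable at z"
    if "(U, \<phi>) \<in> charts M" "(V, \<psi>) \<in> charts N" "z \<in> unit_disk" "fst (f z) \<in> U" "snd (f z) \<in> V"
    for U \<phi> V \<psi> z k
  proof -
    have c: "(U \<times> V, prod_chart \<phi> \<psi>) \<in> charts (product_manifold M N)"
      using that by (auto simp: product_manifold_def)
    have "open (unit_disk \<inter> f -` (U \<times> V))"
      using openin_disk_preimage[OF contf] product_manifold_chart[OF M N c] by simp
    moreover have "(\<lambda>z. prod_chart \<phi> \<psi> (f z) $ k) holomorphic_on (unit_disk \<inter> f -` (U \<times> V))"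
      using f c unfolding holomorphic_disk_def by fast
    ultimately show ?thesis
      using that by (auto intro!: holomorphic_on_imp_differentiable_at simp: mem_Times_iff)
  qed
  have pts: "fst (f z) \<in> points M" "snd (f z) \<in> points N" if "z \<in> unit_disk" for z
    using holomorphic_disk_in_points[OF f that] by (auto simp: mem_Times_iff)
  have "(\<lambda>z. \<phi> (fst (f z)) $ i) holomorphic_on (unit_disk \<inter> (\<lambda>z. fst (f z)) -` U)"
    if U: "(U, \<phi>) \<in> charts M" for U \<phi> i
    unfolding holomorphic_on_def
  proof
    fix z assume z: "z \<in> unit_disk \<inter> (\<lambda>z. fst (f z)) -` U"
    obtain V \<psi> where "(V, \<psi>) \<in> charts N" "snd (f z) \<in> V"
      using complex_manifold_cover[OF N pts(2)] z by blast
    with coord[OF U this(1) _ _ this(2), of "Inl i"] z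
    have "(\<lambda>z. \<phi> (fst (f z)) $ i) field_differentiable at z" by (simp add: prod_chart_Inl)
    then show "(\<lambda>z. \<phi> (fst (f z)) $ i) field_differentiable
        at z within (unit_disk \<inter> (\<lambda>z. fst (f z)) -` U)"
      by (rule field_differentiable_at_within)
  qed
  then show "holomorphic_disk M (\<lambda>z. fst (f z))"
    using cont by (auto simp: holomorphic_disk_def)
  have "(\<lambda>z. \<psi> (snd (f z)) $ i) holomorphic_on (unit_disk \<inter> (\<lambda>z. snd (f z)) -` V)"
    if V: "(V, \<psi>) \<in> charts N" for V \<psi> i
    unfolding holomorphic_on_def
  proof
    fix z assume z: "z \<in> unit_disk \<inter> (\<lambda>z. snd (f z)) -` V"
    obtain U \<phi> where "(U, \<phi>) \<in> charts M" "fst (f z) \<in> U"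
      using complex_manifold_cover[OF M pts(1)] z by blast
    with coord[OF this(1) V _ this(2), of "Inr i"] z
    have "(\<lambda>z. \<psi> (snd (f z)) $ i) field_differentiable at z" by (simp add: prod_chart_Inr)
    then show "(\<lambda>z. \<psi> (snd (f z)) $ i) field_differentiable
        at z within (unit_disk \<inter> (\<lambda>z. snd (f z)) -` V)"
      by (rule field_differentiable_at_within)
  qed
  then show "holomorphic_disk N (\<lambda>z. snd (f z))"
    using cont by (auto simp: holomorphic_disk_def)
qed

text \<open>The pullback of \<open>d\<close> under \<open>H\<close> is again a pseudodistance that
  contracts disks, because \<open>H\<close> maps disks to disks. It therefore lies below the
  greatest such pseudodistance, which is \<open>d\<close>.\<close>

lemma kobayashi_distance_contraction:
  assumes d: "kobayashi_distance M d"
    and H: "\<And>x. x \<in> points M \<Longrightarrow> H x \<in> points M"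
    and disk: "\<And>h. holomorphic_disk M h \<Longrightarrow> holomorphic_disk M (\<lambda>z. H (h z))"
    and "x \<in> points M" "y \<in> points M"
  shows "d (H x) (H y) \<le> d x y"
proof -
  have "pseudodistance_on (points M) (\<lambda>x y. d (H x) (H y))"
    using d H unfolding kobayashi_distance_def pseudodistance_on_def by simp
  moreover have "disk_contracting M (\<lambda>x y. d (H x) (H y))"
    using d disk unfolding kobayashi_distance_def disk_contracting_def by blast
  ultimately show ?thesis using assms(4,5) d unfolding kobayashi_distance_def by blast
qed


section \<open>Nontangential unboundedness\<close>

text \<open>Equivalently, \<open>u\<close> tends to infinity along some nontangential sequence at
  \<open>z0\<close>. Countably many apertures and scales make measurability visible; the apertures
  \<open>real C + 2\<close> exceed 1, as \<open>tends_nontangentially\<close> requires, and are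
  cofinal.\<close>

definition nontangentially_unbounded :: "(complex \<Rightarrow> real) \<Rightarrow> complex set" where
  "nontangentially_unbounded u =
     (\<Union>C. \<Inter>N. {z0. \<exists>z\<in>stolz_region (real C + 2) z0. cmod (z - z0) < 1 / (real N + 1) \<and> u z > real N})"

text \<open>For fixed \<open>z\<close> the Stolz condition on the vertex says that \<open>z0\<close>
  lies in the ball of radius \<open>C * (1 - cmod z)\<close> about \<open>z\<close>. With all
  parameters fixed, the set is a union of open sets over the \<open>z\<close> with
  \<open>u z > N\<close>, whatever the function \<open>u\<close> is.\<close>

lemma borel_nontangentially_unbounded: "nontangentially_unbounded u \<in> sets borel"
proof -
  have "open {z0. \<exists>z\<in>stolz_region C z0. cmod (z - z0) < r \<and> u z > N}" for C r N :: real
  proof -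
    have "{z0. \<exists>z\<in>stolz_region C z0. cmod (z - z0) < r \<and> u z > N}
        = (\<Union>z\<in>{z \<in> unit_disk. u z > N}. ball z (C * (1 - cmod z)) \<inter> ball z r)"
      by (auto simp: stolz_region_def dist_norm)
    then show ?thesis by auto
  qed
  then show ?thesis
    unfolding nontangentially_unbounded_def
    by (intro sets.countable_UN sets.countable_INT image_subsetI borel_open) auto
qed

text \<open>The aperture is fixed before \<open>N\<close> varies, so one witness for each
  \<open>N\<close> gives a sequence inside a single Stolz region.\<close>

lemma nontangentially_unbounded_sequence:
  assumes "z0 \<in> nontangentially_unbounded u"
  obtains z where "tends_nontangentially z z0" "filterlim (\<lambda>n. u (z n)) at_top sequentially"
proof -
  obtain C where "\<forall>N. \<exists>z\<in>stolz_region (real C + 2) z0.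
      cmod (z - z0) < 1 / (real N + 1) \<and> u z > real N"
    using assms by (auto simp: nontangentially_unbounded_def)
  then obtain z where z: "\<And>N. z N \<in> stolz_region (real C + 2) z0"
      "\<And>N. cmod (z N - z0) < 1 / (real N + 1)" "\<And>N. u (z N) > real N"
    by metis
  have "(\<lambda>n. z n - z0) \<longlonglongrightarrow> 0"
    by (rule Lim_null_comparison[OF _ LIMSEQ_inverse_real_of_nat])
       (use z(2) in \<open>auto simp: inverse_eq_divide add.commute intro!: always_eventually less_imp_le\<close>)
  then have "z \<longlonglongrightarrow> z0" by (simp add: LIM_zero_iff)
  moreover have "real C + 2 > 1" by simp
  ultimately have "tends_nontangentially z z0"
    unfolding tends_nontangentially_def using z(1) by blast
  moreover have "filterlim (\<lambda>n. u (z n)) at_top sequentially"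
    by (rule filterlim_at_top_mono[OF filterlim_real_sequentially])
       (use z(3) in \<open>auto intro!: always_eventually less_imp_le\<close>)
  ultimately show thesis by (rule that)
qed

text \<open>If \<open>z0\<close> lay in neither set, \<open>u\<close> and \<open>v\<close> would
  both be eventually bounded above along \<open>z\<close>, and so would \<open>w\<close>.\<close>

lemma nontangentially_unbounded_add:
  assumes z: "tends_nontangentially z z0" and lim: "filterlim (\<lambda>n. w (z n)) at_top sequentially"
    and le: "\<And>z. z \<in> unit_disk \<Longrightarrow> w z \<le> u z + v z"
  shows "z0 \<in> nontangentially_unbounded u \<union> nontangentially_unbounded v"
proof (rule ccontr)
  assume no: "z0 \<notin> nontangentially_unbounded u \<union> nontangentially_unbounded v"
  obtain C0 where C0: "\<And>n. z n \<in> stolz_region C0 z0" and conv: "z \<longlonglongrightarrow> z0"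
    using z by (auto simp: tends_nontangentially_def)
  \<comment> \<open>The given aperture is replaced by a larger one from the countable family; Stolz
    regions grow with the aperture.\<close>
  obtain C :: nat where C: "C0 \<le> real C" using real_arch_simple by blast
  have stolz: "z n \<in> stolz_region (real C + 2) z0" for n
  proof -
    have zn: "z n \<in> unit_disk" and "cmod (z n - z0) < C0 * (1 - cmod (z n))"
      using C0[of n] by (auto simp: stolz_region_def)
    note this(2)
    also have "C0 * (1 - cmod (z n)) \<le> (real C + 2) * (1 - cmod (z n))"
      using C zn(1) by (intro mult_right_mono) auto
    finally show ?thesis using zn(1) by (simp add: stolz_region_def)
  qed
  have bdd: "\<exists>N. \<forall>\<^sub>F n in sequentially. h (z n) \<le> real N"
    if h: "z0 \<notin> nontangentially_unbounded h" for h
  proof -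
    \<comment> \<open>The same \<open>N\<close> fixes the neighbourhood of \<open>z0\<close> and the
      bound for \<open>h\<close> there.\<close>
    obtain N where N: "\<And>z. z \<in> stolz_region (real C + 2) z0 \<Longrightarrow>
        cmod (z - z0) < 1 / (real N + 1) \<Longrightarrow> h z \<le> real N"
      using h unfolding nontangentially_unbounded_def by (simp add: not_less) (metis not_less)
    have "\<forall>\<^sub>F n in sequentially. cmod (z n - z0) < 1 / (real N + 1)"
      using tendstoD[OF conv, of "1 / (real N + 1)"] by (simp add: dist_norm)
    then have "\<forall>\<^sub>F n in sequentially. h (z n) \<le> real N"
      by eventually_elim (use N stolz in blast)
    then show ?thesis by blast
  qed
  obtain N1 N2 where "\<forall>\<^sub>F n in sequentially. u (z n) \<le> real N1"
    "\<forall>\<^sub>F n in sequentially. v (z n) \<le> real N2"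
    using bdd no by blast
  moreover have "\<forall>\<^sub>F n in sequentially. w (z n) > real N1 + real N2"
    using lim by (simp add: filterlim_at_top_dense)
  ultimately have "\<forall>\<^sub>F n in sequentially. False"
  proof eventually_elim
    case (elim n)
    moreover have "z n \<in> unit_disk" using stolz[of n] by (simp add: stolz_region_def)
    ultimately show ?case using le[of "z n"] by linarith
  qed
  then show False by simp
qed

text \<open>Subadditivity of Lebesgue measure on the arguments. \<open>A\<close> and
  \<open>B\<close> are Borel so that their preimages under the continuous map \<open>cis\<close> are
  measurable.\<close>

lemma positive_linear_measure_cover:
  assumes E: "positive_linear_measure E" and sub: "E \<subseteq> A \<union> B"
    and A: "A \<in> sets borel" and B: "B \<in> sets borel"
  shows "positive_linear_measure (E \<inter> A) \<or> positive_linear_measure (E \<inter> B)"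
proof -
  have Em: "circle_arguments E \<in> sets lebesgue" and Epos: "emeasure lebesgue (circle_arguments E) > 0"
    using E by (auto simp: positive_linear_measure_def)
  have meas: "circle_arguments (E \<inter> X) \<in> sets lebesgue" if "X \<in> sets borel" for X
  proof -
    have "cis \<in> borel_measurable borel"
      by (intro borel_measurable_continuous_onI continuous_intros)
    then have "cis -` X \<in> sets borel"
      using that by (metis measurable_sets_borel)
    then have "cis -` X \<in> sets lebesgue" by simp
    moreover have "circle_arguments (E \<inter> X) = circle_arguments E \<inter> cis -` X"
      by (auto simp: circle_arguments_def)
    ultimately show ?thesis using Em by simp
  qed
  have "circle_arguments E = circle_arguments (E \<inter> A) \<union> circle_arguments (E \<inter> B)"
    using sub by (auto simp: circle_arguments_def)
  then have "emeasure lebesgue (circle_arguments E)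
      \<le> emeasure lebesgue (circle_arguments (E \<inter> A)) + emeasure lebesgue (circle_arguments (E \<inter> B))"
    using emeasure_subadditive meas A B by metis
  then have "emeasure lebesgue (circle_arguments (E \<inter> A)) > 0
      \<or> emeasure lebesgue (circle_arguments (E \<inter> B)) > 0"
    using Epos by (metis add.right_neutral leD not_gr_zero)
  then show ?thesis
    using E meas A B by (auto simp: positive_linear_measure_def)
qed

text \<open>By the triangle inequality \<open>d x0 (g2 z)\<close> is at least
  \<open>d x0 (g1 z) - d (g1 z) (g2 z)\<close>, so the Gromov product of \<open>g1 z\<close> and
  \<open>g2 z\<close> is at least \<open>d x0 (g1 z) - K\<close>. It diverges wherever
  \<open>d x0 (g1 z)\<close> does.\<close>

lemma not_rigid_if_bounded_distance:
  assumes d: "pseudodistance_on (points M) d" and x0: "x0 \<in> points M"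
    and g1: "holomorphic_disk M g1" and g2: "holomorphic_disk M g2"
    and K: "\<And>z. z \<in> unit_disk \<Longrightarrow> d (g1 z) (g2 z) \<le> K"
    and ne: "g1 0 \<noteq> g2 0"
    and E: "positive_linear_measure E"
    and unb: "E \<subseteq> nontangentially_unbounded (\<lambda>z. d x0 (g1 z))"
  shows "\<not> rigidity_property M d x0"
proof
  assume rigid: "rigidity_property M d x0"
  have "\<exists>z. tends_nontangentially z z0 \<and>
      filterlim (\<lambda>n. gromov_product d x0 (g1 (z n)) (g2 (z n))) at_top sequentially"
    if "z0 \<in> E" for z0
  proof -
    obtain z where z: "tends_nontangentially z z0"
      and lim: "filterlim (\<lambda>n. d x0 (g1 (z n))) at_top sequentially"
      using nontangentially_unbounded_sequence \<open>z0 \<in> E\<close> unb by blast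
    have "- K + d x0 (g1 (z n)) \<le> gromov_product d x0 (g1 (z n)) (g2 (z n))" for n
    proof -
      have zn: "z n \<in> unit_disk"
        using z by (auto simp: tends_nontangentially_def stolz_region_def)
      then have "g1 (z n) \<in> points M" "g2 (z n) \<in> points M"
        using g1 g2 holomorphic_disk_in_points by blast+
      then have "d x0 (g1 (z n)) \<le> d x0 (g2 (z n)) + d (g2 (z n)) (g1 (z n))"
        "d (g2 (z n)) (g1 (z n)) = d (g1 (z n)) (g2 (z n))"
        using d x0 by (auto simp: pseudodistance_on_def)
      then show ?thesis using K[OF zn] by (simp add: gromov_product_def)
    qed
    then have "filterlim (\<lambda>n. gromov_product d x0 (g1 (z n)) (g2 (z n))) at_top sequentially"
      by (intro filterlim_at_top_mono[OF filterlim_tendsto_add_at_top[OF tendsto_const lim]])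
         (rule always_eventually, blast)
    with z show ?thesis by blast
  qed
  then have "\<forall>z\<in>unit_disk. g1 z = g2 z"
    using rigid g1 g2 E unfolding rigidity_property_def by blast
  then show False using ne by simp
qed


section \<open>Product manifolds are not rigid\<close>

theorem mainTheorem4:
  fixes \<Omega> :: "('a, 'n::finite) charted"
    and M1 :: "('b, 'm1::finite) charted"
    and M2 :: "('c, 'm2::finite) charted"
    and d :: "'a \<Rightarrow> 'a \<Rightarrow> real"
    and x0 :: 'a
    and f :: "complex \<Rightarrow> 'a"
    and E :: "complex set"
  assumes "complex_manifold \<Omega>"
    and "kobayashi_distance \<Omega> d"
    and "x0 \<in> points \<Omega>"
    and "complex_manifold M1" and "complex_manifold M2"
    and "biholomorphic \<Omega> (product_manifold M1 M2)"
    and "holomorphic_disk \<Omega> f"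
    and "positive_linear_measure E"
    and "\<forall>z0\<in>E. \<exists>z. tends_nontangentially z z0 \<and>
           filterlim (\<lambda>n. d x0 (f (z n))) at_top sequentially"
  shows "\<not> rigidity_property \<Omega> d x0"
proof -

  \<comment> \<open>Transport of points and disks through the biholomorphism\<close>
  let ?P = "product_manifold M1 M2"
  note M1 = \<open>complex_manifold M1\<close> and M2 = \<open>complex_manifold M2\<close>
  obtain F G where hom: "homeomorphic_maps (mtop \<Omega>) (mtop ?P) F G"
    and F: "holomorphic_map \<Omega> ?P F" and G: "holomorphic_map ?P \<Omega> G"
    using assms(6) by (auto simp: biholomorphic_def)
  have GF: "G (F x) = x" if "x \<in> points \<Omega>" for x
    using hom that by (simp add: homeomorphic_maps_def)
  have FG: "F (G (a, b)) = (a, b)" if "a \<in> points M1" "b \<in> points M2" for a b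
    using hom that by (simp add: homeomorphic_maps_def)
  have G_pts: "G (a, b) \<in> points \<Omega>" if "a \<in> points M1" "b \<in> points M2" for a b
  proof -
    have "(a, b) \<in> points ?P" using that by simp
    then show ?thesis
      using hom unfolding homeomorphic_maps_def continuous_map_def by fast
  qed
  have F_pts: "fst (F x) \<in> points M1" "snd (F x) \<in> points M2" if "x \<in> points \<Omega>" for x
  proof -
    have "F x \<in> points ?P"
      using hom that unfolding homeomorphic_maps_def continuous_map_def by fast
    then show "fst (F x) \<in> points M1" "snd (F x) \<in> points M2" by (auto simp: mem_Times_iff)
  qed
  have F_disk: "holomorphic_disk M1 (\<lambda>z. fst (F (h z)))" "holomorphic_disk M2 (\<lambda>z. snd (F (h z)))"
    if "holomorphic_disk \<Omega> h" for h
    using holomorphic_disk_comp[OF complex_manifold_cover complex_manifold_chart that F] assms(1)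
      holomorphic_disk_fst[OF M1 M2] holomorphic_disk_snd[OF M1 M2] by blast+
  have G_disk: "holomorphic_disk \<Omega> (\<lambda>z. G (h z, k z))"
    if "holomorphic_disk M1 h" "holomorphic_disk M2 k" for h k
    by (rule holomorphic_disk_comp[OF product_manifold_cover product_manifold_chart
          holomorphic_disk_Pair[OF that] G]) (use M1 M2 in auto)
  have pd: "pseudodistance_on (points \<Omega>) d"
    using assms(2) by (simp add: kobayashi_distance_def)

  \<comment> \<open>Distances within the fibres\<close>
  have fibre2: "d (G (a, b)) (G (a, b')) \<le> d (G (a', b)) (G (a', b'))"
    if "a \<in> points M1" "a' \<in> points M1" "b \<in> points M2" "b' \<in> points M2" for a a' b b'
  proof -
    \<comment> \<open>\<open>?H\<close> replaces the first component by the constant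
      \<open>a\<close> and carries the pair over \<open>a'\<close> to the pair over
      \<open>a\<close>. Exchanging \<open>a\<close> and \<open>a'\<close> gives equality.\<close>
    let ?H = "\<lambda>x. G (a, snd (F x))"
    have "d (?H (G (a', b))) (?H (G (a', b'))) \<le> d (G (a', b)) (G (a', b'))"
      by (rule kobayashi_distance_contraction[OF assms(2)])
         (use that in \<open>simp_all add: F_pts G_pts F_disk G_disk holomorphic_disk_const\<close>)
    then show ?thesis using that FG by simp
  qed
  have fibre1: "d (G (a, b)) (G (a', b)) \<le> d (G (a, b')) (G (a', b'))"
    if "a \<in> points M1" "a' \<in> points M1" "b \<in> points M2" "b' \<in> points M2" for a a' b b'
  proof -
    let ?H = "\<lambda>x. G (fst (F x), b)"
    have "d (?H (G (a, b'))) (?H (G (a', b'))) \<le> d (G (a, b')) (G (a', b'))"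
      by (rule kobayashi_distance_contraction[OF assms(2)])
         (use that in \<open>simp_all add: F_pts G_pts F_disk G_disk holomorphic_disk_const\<close>)
    then show ?thesis using that FG by simp
  qed

  \<comment> \<open>Splitting the distance from \<open>x0\<close> between the components of
    \<open>f\<close>\<close>
  define x1 x2 where "x1 = fst (F x0)" and "x2 = snd (F x0)"
  define f1 f2 where "f1 = (\<lambda>z. fst (F (f z)))" and "f2 = (\<lambda>z. snd (F (f z)))"
  have x: "x1 \<in> points M1" "x2 \<in> points M2" "x0 = G (x1, x2)"
    using F_pts GF assms(3) by (auto simp: x1_def x2_def)
  have f12: "holomorphic_disk M1 f1" "holomorphic_disk M2 f2"
    using F_disk assms(7) by (auto simp: f1_def f2_def)
  have f_pts: "f1 z \<in> points M1" "f2 z \<in> points M2" if "z \<in> unit_disk" for z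
    using f12 that holomorphic_disk_in_points by blast+
  let ?u = "\<lambda>z. d x0 (G (f1 z, x2))" and ?v = "\<lambda>z. d x0 (G (x1, f2 z))"
  have le: "d x0 (f z) \<le> ?u z + ?v z" if z: "z \<in> unit_disk" for z
  proof -
    have fz: "f z = G (f1 z, f2 z)"
      using GF holomorphic_disk_in_points[OF assms(7) z] by (simp add: f1_def f2_def)
    \<comment> \<open>The intermediate point \<open>G (f1 z, x2)\<close> differs from
      \<open>f z\<close> in the second component alone, so \<open>fibre2\<close> moves the remaining
      distance to the fibre over \<open>x1\<close>.\<close>
    have "d x0 (f z) \<le> ?u z + d (G (f1 z, x2)) (G (f1 z, f2 z))"
      using pd assms(3) G_pts x(2) f_pts[OF z] unfolding fz pseudodistance_on_def by simp
    moreover have "d (G (f1 z, x2)) (G (f1 z, f2 z)) \<le> ?v z"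
      unfolding x(3) using fibre2 f_pts[OF z] x(1,2) by blast
    ultimately show ?thesis by linarith
  qed
  have "E \<subseteq> nontangentially_unbounded ?u \<union> nontangentially_unbounded ?v"
  proof
    fix z0 assume "z0 \<in> E"
    then obtain z where "tends_nontangentially z z0"
      "filterlim (\<lambda>n. d x0 (f (z n))) at_top sequentially"
      using assms(9) by blast
    then show "z0 \<in> nontangentially_unbounded ?u \<union> nontangentially_unbounded ?v"
      by (rule nontangentially_unbounded_add[where w = "\<lambda>z. d x0 (f z)"]) (rule le)
  qed
  from positive_linear_measure_cover[OF assms(8) this
      borel_nontangentially_unbounded borel_nontangentially_unbounded]
  show ?thesis
  proof
    assume E': "positive_linear_measure (E \<inter> nontangentially_unbounded ?u)"
    \<comment> \<open>The first component escapes here, so the disks share \<open>f1\<close> and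
      differ in a constant second component.\<close>
    obtain c where c: "c \<in> points M2" "c \<noteq> x2"
      using complex_manifold_other_point[OF M2 x(2)] .
    show ?thesis
    proof (rule not_rigid_if_bounded_distance[where ?g1.0 = "\<lambda>z. G (f1 z, x2)" and
          ?g2.0 = "\<lambda>z. G (f1 z, c)", OF pd assms(3) _ _ _ _ E'])
      show "holomorphic_disk \<Omega> (\<lambda>z. G (f1 z, x2))" "holomorphic_disk \<Omega> (\<lambda>z. G (f1 z, c))"
        by (intro G_disk f12 holomorphic_disk_const x(2) c(1))+
      \<comment> \<open>Moving both points to the fibre over \<open>x1\<close> gives a bound
        independent of \<open>z\<close>.\<close>
      show "d (G (f1 z, x2)) (G (f1 z, c)) \<le> d (G (x1, x2)) (G (x1, c))" if "z \<in> unit_disk" for z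
        using fibre2 f_pts[OF that] x(1,2) c(1) by blast
      show "G (f1 0, x2) \<noteq> G (f1 0, c)"
        using FG[of "f1 0" x2] FG[of "f1 0" c] f_pts[of 0] x(2) c by auto
    qed simp
  next
    assume E': "positive_linear_measure (E \<inter> nontangentially_unbounded ?v)"
    \<comment> \<open>The same with the factors exchanged: the disks share \<open>f2\<close>, and
      \<open>fibre1\<close> bounds their distance.\<close>
    obtain c where c: "c \<in> points M1" "c \<noteq> x1"
      using complex_manifold_other_point[OF M1 x(1)] .
    show ?thesis
    proof (rule not_rigid_if_bounded_distance[where ?g1.0 = "\<lambda>z. G (x1, f2 z)" and
          ?g2.0 = "\<lambda>z. G (c, f2 z)", OF pd assms(3) _ _ _ _ E'])
      show "holomorphic_disk \<Omega> (\<lambda>z. G (x1, f2 z))" "holomorphic_disk \<Omega> (\<lambda>z. G (c, f2 z))"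
        by (intro G_disk f12 holomorphic_disk_const x(1) c(1))+
      show "d (G (x1, f2 z)) (G (c, f2 z)) \<le> d (G (x1, x2)) (G (c, x2))" if "z \<in> unit_disk" for z
        using fibre1 f_pts[OF that] x(1,2) c(1) by blast
      show "G (x1, f2 0) \<noteq> G (c, f2 0)"
        using FG[of x1 "f2 0"] FG[of c "f2 0"] f_pts[of 0] x(1) c by auto
    qed simp
  qed
qed

end
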